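(* Let $G=(V,E)$ be a graph. A set $P\subseteq V$ is a global $(\mathbb{Z},\{o\in\mathbb{Z} : o\geq 0\})$-alliance if and only if $\mathrm{MAJ}^1(P)=V$.
   Context: Graphs are finite and simple. For a graph $G=(V,E)$, $S\subseteq V$ and $v\in V$, $N_S(v)$ is the set of neighbors of $v$ lying in $S$, $\delta_S(v)=|N_S(v)|$, $\overline{S}=V\setminus S$, $N(v)=N_V(v)$ is the open neighborhood, $N(S)=\bigcup_{u\in S}N(u)$ and $N[S]=N(S)\cup S$. A set $S$ is dominating if $N[S]=V$. For $D,O\subseteq\mathbb{Z}$, a $(D,O)$-alliance in $G$ is a vertex set $S$ such that (1) $\delta_S(v)-\delta_{\overline{S}}(v)\in D$ for all $v\in S$, and (2) $\delta_S(v)-\delta_{\overline{S}}(v)\in O$ for all $v\in N(S)\setminus S$. It is called global if $S$ is also a dominating set. For $P\subseteq V$, $\mathrm{MAJ}(P)=\{v\in V : |N(v)\cap P|\geq \frac{1}{2}|N(v)|\}\cup P$, and $\mathrm{MAJ}^1(P)=\mathrm{MAJ}(P)$.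
   Formalization: The direction from MAJ^1(P)=V to global alliance is proved under the added assumption that every isolated vertex of G lies in P; without it the claim fails (one vertex, no edges, P empty). The other direction is proved without this assumption. *)

theory Defs
  imports "Graph_Theory.Pair_Digraph"
begin

text \<open>
  A finite simple graph is a \<open>pair_graph\<close>: finite vertex set, and an edge set given as
  a symmetric, loop-free set of pairs (each edge is present in both orientations).
\<close>

definition nbrs_in :: "'a pair_pre_digraph \<Rightarrow> 'a set \<Rightarrow> 'a \<Rightarrow> 'a set" where
  "nbrs_in G S v = {u \<in> S. (v, u) \<in> parcs G}"

definition deg_in :: "'a pair_pre_digraph \<Rightarrow> 'a set \<Rightarrow> 'a \<Rightarrow> nat" where
  "deg_in G S v = card (nbrs_in G S v)"

definition nbrs :: "'a pair_pre_digraph \<Rightarrow> 'a \<Rightarrow> 'a set" where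
  "nbrs G v = nbrs_in G (pverts G) v"

definition set_nbrs :: "'a pair_pre_digraph \<Rightarrow> 'a set \<Rightarrow> 'a set" where
  "set_nbrs G S = (\<Union>u\<in>S. nbrs G u)"

definition dominating :: "'a pair_pre_digraph \<Rightarrow> 'a set \<Rightarrow> bool" where
  "dominating G S \<longleftrightarrow> S \<subseteq> pverts G \<and> set_nbrs G S \<union> S = pverts G"

definition alliance :: "'a pair_pre_digraph \<Rightarrow> int set \<Rightarrow> int set \<Rightarrow> 'a set \<Rightarrow> bool" where
  "alliance G D Ofs S \<longleftrightarrow> S \<subseteq> pverts G
     \<and> (\<forall>v\<in>S. int (deg_in G S v) - int (deg_in G (pverts G - S) v) \<in> D)
     \<and> (\<forall>v\<in>set_nbrs G S - S. int (deg_in G S v) - int (deg_in G (pverts G - S) v) \<in> Ofs)"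

definition global_alliance ::
    "'a pair_pre_digraph \<Rightarrow> int set \<Rightarrow> int set \<Rightarrow> 'a set \<Rightarrow> bool" where
  "global_alliance G D Ofs S \<longleftrightarrow> alliance G D Ofs S \<and> dominating G S"

text \<open>
  An isolated vertex satisfies the majority condition vacuously, so it lies in
  \<open>MAJ G P\<close> for every \<open>P\<close>, whereas a dominating set has to contain it.
\<close>

definition MAJ :: "'a pair_pre_digraph \<Rightarrow> 'a set \<Rightarrow> 'a set" where
  "MAJ G P =
     {v \<in> pverts G. real (card (nbrs G v \<inter> P)) \<ge> 1 / 2 * real (card (nbrs G v))} \<union> P"

end

theory Submission
  imports Defs
begin

text \<open>
  For a vertex \<open>v\<close>, the sets \<open>N\<^sub>P(v)\<close> and \<open>N\<^bsub>V - P\<^esub>(v)\<close> partition \<open>N(v)\<close>, so \<open>v\<close> has at least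
  half of its neighbours in \<open>P\<close> exactly when \<open>\<delta>\<^sub>P(v) - \<delta>\<^bsub>V - P\<^esub>(v) \<ge> 0\<close>
  (\<open>majority_iff_deg_diff_nonneg\<close>). The condition imposed on the members of \<open>P\<close> by the
  alliance is void, hence the alliance condition is the majority condition on \<open>N(P) - P\<close>.
  If \<open>P\<close> dominates, \<open>N(P) - P\<close> is all of \<open>V - P\<close>. Conversely, a non-isolated vertex having at
  least half of its neighbours in \<open>P\<close> has at least one there, so if \<open>P\<close> contains the isolated
  vertices, the majority condition on \<open>V - P\<close> already makes \<open>P\<close> dominating.
\<close>

lemma nbrs_Int:
  assumes "P \<subseteq> pverts G"
  shows "nbrs G v \<inter> P = nbrs_in G P v"
  using assms by (auto simp: nbrs_def nbrs_in_def)

lemma card_nbrs_eq_deg_in_add: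
  assumes "pair_graph G" and "P \<subseteq> pverts G"
  shows "card (nbrs G v) = deg_in G P v + deg_in G (pverts G - P) v"
proof -
  interpret pair_graph G by fact
  have "finite (nbrs_in G P v)" "finite (nbrs_in G (pverts G - P) v)"
    using assms(2) finite_subset[OF _ pair_finite_verts] by (auto simp: nbrs_in_def)
  moreover have "nbrs_in G P v \<inter> nbrs_in G (pverts G - P) v = {}"
    by (auto simp: nbrs_in_def)
  moreover have "nbrs G v = nbrs_in G P v \<union> nbrs_in G (pverts G - P) v"
    using assms(2) by (auto simp: nbrs_def nbrs_in_def)
  ultimately show ?thesis
    by (simp add: deg_in_def card_Un_disjoint)
qed

lemma majority_iff_deg_diff_nonneg:
  assumes "pair_graph G" and "P \<subseteq> pverts G"
  shows "real (card (nbrs G v \<inter> P)) \<ge> 1 / 2 * real (card (nbrs G v))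
    \<longleftrightarrow> int (deg_in G P v) - int (deg_in G (pverts G - P) v) \<ge> 0"
  using card_nbrs_eq_deg_in_add[OF assms, of v] nbrs_Int[OF assms(2), of v]
  by (auto simp: deg_in_def)

text \<open>
  By symmetry of adjacency, \<open>N(P)\<close> consists of the vertices that have a neighbour in \<open>P\<close>.
\<close>

lemma mem_set_nbrs_iff:
  assumes "pair_graph G" and "P \<subseteq> pverts G"
  shows "v \<in> set_nbrs G P \<longleftrightarrow> nbrs G v \<inter> P \<noteq> {}"
proof -
  interpret pair_graph G by fact
  have "(u, v) \<in> parcs G \<longleftrightarrow> (v, u) \<in> parcs G" for u
    using arcs_symmetric by blast
  moreover have "v \<in> pverts G" if "(u, v) \<in> parcs G" for u
    using that by (rule in_arcsD2)
  ultimately show ?thesis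
    using assms(2) by (auto simp: set_nbrs_def nbrs_def nbrs_in_def)
qed

lemma MAJ_eq_pverts_iff:
  assumes "pair_graph G" and "P \<subseteq> pverts G"
  shows "MAJ G P = pverts G
    \<longleftrightarrow> (\<forall>v\<in>pverts G - P. int (deg_in G P v) - int (deg_in G (pverts G - P) v) \<ge> 0)"
  unfolding MAJ_def majority_iff_deg_diff_nonneg[OF assms] using assms(2) by auto

lemma global_alliance_nonneg_iff:
  assumes "pair_graph G" and "P \<subseteq> pverts G"
  shows "global_alliance G UNIV {k. k \<ge> 0} P
    \<longleftrightarrow> MAJ G P = pverts G \<and> dominating G P"
proof -
  have "set_nbrs G P - P = pverts G - P" if "dominating G P"
    using that by (auto simp: dominating_def)
  then show ?thesis
    using assms(2)
    by (auto simp: global_alliance_def alliance_def MAJ_eq_pverts_iff[OF assms])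
qed

lemma dominating_if_MAJ_eq:
  assumes "pair_graph G" and "P \<subseteq> pverts G"
    and maj: "MAJ G P = pverts G"
    and isolated: "\<forall>v\<in>pverts G. nbrs G v = {} \<longrightarrow> v \<in> P"
  shows "dominating G P"
proof -
  interpret pair_graph G by fact
  have "v \<in> set_nbrs G P" if v: "v \<in> pverts G" "v \<notin> P" for v
  proof -
    have "finite (nbrs G v)"
      by (simp add: nbrs_def nbrs_in_def)
    moreover have "nbrs G v \<noteq> {}"
      using isolated v by blast
    ultimately have "card (nbrs G v) > 0"
      by (simp add: card_gt_0_iff)
    moreover have "real (card (nbrs G v \<inter> P)) \<ge> 1 / 2 * real (card (nbrs G v))"
      using maj v by (auto simp: MAJ_def)
    ultimately have "nbrs G v \<inter> P \<noteq> {}"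
      by auto
    then show ?thesis
      using mem_set_nbrs_iff[OF assms(1,2)] by blast
  qed
  moreover have "set_nbrs G P \<subseteq> pverts G"
    by (auto simp: set_nbrs_def nbrs_def nbrs_in_def)
  ultimately show ?thesis
    using assms(2) by (auto simp: dominating_def)
qed

theorem proposition13:
  fixes G :: "'a pair_pre_digraph" and P :: "'a set"
  assumes "pair_graph G" and "P \<subseteq> pverts G"
  shows "(global_alliance G UNIV {k. k \<ge> 0} P \<longrightarrow> MAJ G P = pverts G)
    \<and> ((\<forall>v\<in>pverts G. nbrs G v = {} \<longrightarrow> v \<in> P)
        \<longrightarrow> (global_alliance G UNIV {k. k \<ge> 0} P \<longleftrightarrow> MAJ G P = pverts G))"
  using global_alliance_nonneg_iff[OF assms] dominating_if_MAJ_eq[OF assms] by blast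

end
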